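(* The bound function $$B_{\mathrm{sq},\chi^2}(Q)=\sum_{i=1}^H\hat l_iq_i+\sqrt[4]{\left(\sum_{i=1}^H\frac{q_i^2}{p_i}\right)\left(\frac{12m-11}{16m^3\delta}\right)}$$ is non-convex (as a function of $Q=(q_1,\dots,q_H)\in\Delta^H$).
   Context: $\mathcal H=\{h_1,\dots,h_H\}$ is a finite set of $H$ classifiers; $\Delta^H=\{(q_1,\dots,q_H):q_i\ge0\ \forall i,\ \sum_{i=1}^Hq_i=1\}$ is the probability simplex of posterior distributions $Q$ on $\mathcal H$; $P=(p_1,\dots,p_H)$ is a prior distribution on $\mathcal H$ with $p_i>0$ and $\sum_{i=1}^Hp_i=1$; $\hat l_i\in[0,1]$ is the empirical risk of the classifier $h_i$ computed on a sample of size $m$; $m$ is a positive integer (the sample size); $\delta\in(0,1)$ is the confidence parameter. The function $B_{\mathrm{sq},\chi^2}$ is the PAC-Bayesian upper bound on the posterior-averaged true risk obtained from the squared distance function $\phi_{\mathrm{sq}}(\hat l,l)=(\hat l-l)^2$ and the chi-squared divergence between $Q$ and $P$.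
   Formalization: The formal statement adds the hypothesis that some prior weight p_i is less than 1/3; if every p_i ≥ 1/3 (e.g. H = 1, or H = 2 with the uniform prior) the bound is convex on Δ^H, so the claim fails there. The added condition always holds for H ≥ 4. *)

theory Defs
  imports "HOL-Analysis.Analysis"
begin

definition prob_simplex :: "(real ^ 'h) set" where
  "prob_simplex = {q. (\<forall>i. 0 \<le> q $ i) \<and> (\<Sum>i\<in>UNIV. q $ i) = 1}"

text \<open>
  The classifiers are indexed by the finite type \<open>'h\<close>, so \<open>H = CARD('h)\<close>. The arguments are the
  empirical risks \<open>l\<close>, the prior \<open>p\<close>, the sample size \<open>m\<close>, the confidence parameter \<open>\<delta>\<close> and the
  posterior \<open>q\<close>.
\<close>
definition B_sq_chi2 ::
    "real ^ 'h \<Rightarrow> real ^ 'h \<Rightarrow> nat \<Rightarrow> real \<Rightarrow> real ^ 'h \<Rightarrow> real" where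
  "B_sq_chi2 l p m \<delta> q =
     (\<Sum>i\<in>UNIV. l $ i * q $ i) +
     root 4 ((\<Sum>i\<in>UNIV. (q $ i)\<^sup>2 / p $ i) *
             ((12 * real m - 11) / (16 * real m ^ 3 * \<delta>)))"

text \<open>
  Non-convexity on the simplex fails for some priors: if every prior weight is at least \<open>1/3\<close>
  (one classifier, two classifiers with balanced prior, three with uniform prior), the bound is
  convex. This is \<open>B_sq_chi2_convex\<close> below; hence a prior weight below \<open>1/3\<close> is necessary for
  non-convexity. It is always present when there are at least four classifiers
  (\<open>exists_prior_less_third\<close>).
\<close>

lemma exists_prior_less_third:
  fixes p :: "real ^ 'h"
  assumes sum_p: "(\<Sum>i\<in>UNIV. p $ i) = 1" and "4 \<le> CARD('h)"
  shows "\<exists>i. p $ i < 1 / 3"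
proof (rule ccontr)
  assume "\<not> ?thesis"
  then have "(\<Sum>i\<in>(UNIV::'h set). 1 / 3) \<le> (\<Sum>i\<in>UNIV. p $ i)"
    by (intro sum_mono) (auto simp: not_less)
  with sum_p have "real CARD('h) \<le> 3" by simp
  with assms(2) show False by linarith
qed

lemma convex_prob_simplex: "convex (prob_simplex :: (real ^ 'h) set)"
  unfolding convex_def prob_simplex_def
  by (auto simp: sum.distrib simp flip: sum_distrib_left)

lemma convex_on_powr_quarter:
  "convex_on {0..sqrt 2} (\<lambda>t. (1 + t\<^sup>2) powr (1 / 4))"
proof (rule f''_ge0_imp_convex)
  have pos: "1 + t\<^sup>2 > 0" for t :: real
    by (simp add: add_pos_nonneg)
  show "((\<lambda>t. (1 + t\<^sup>2) powr (1 / 4)) has_real_derivative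
         t / 2 * (1 + t\<^sup>2) powr (- 3 / 4)) (at t)" for t :: real
    by (rule derivative_eq_intros refl pos | simp)+
  show "((\<lambda>t. t / 2 * (1 + t\<^sup>2) powr (- 3 / 4)) has_real_derivative
         (1 / 2 - t\<^sup>2 / 4) * (1 + t\<^sup>2) powr (- 7 / 4)) (at t)" for t :: real
  proof -
    have "(1 + t\<^sup>2) powr (- 3 / 4) = (1 + t\<^sup>2) powr (1 + - 7 / 4)"
      by simp
    also have "\<dots> = (1 + t\<^sup>2) * (1 + t\<^sup>2) powr (- 7 / 4)"
      using pos[of t] by (subst powr_add) simp
    finally have eq: "(1 + t\<^sup>2) powr (- 3 / 4) = (1 + t\<^sup>2) * (1 + t\<^sup>2) powr (- 7 / 4)" .
    have "((\<lambda>t. t / 2 * (1 + t\<^sup>2) powr (- 3 / 4)) has_real_derivative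
         1 / 2 * (1 + t\<^sup>2) powr (- 3 / 4)
         + t / 2 * (- 3 / 4 * (1 + t\<^sup>2) powr (- 7 / 4) * (2 * t))) (at t)"
      by (rule derivative_eq_intros refl pos | simp)+
    then show ?thesis
      by (rule DERIV_cong) (simp only: eq, simp add: field_simps power2_eq_square)
  qed
  show "0 \<le> (1 / 2 - t\<^sup>2 / 4) * (1 + t\<^sup>2) powr (- 7 / 4)" if "t \<in> {0..sqrt 2}" for t :: real
  proof -
    have "t\<^sup>2 \<le> (sqrt 2)\<^sup>2"
      using that by (intro power_mono) auto
    then show ?thesis by simp
  qed
qed simp

lemma B_sq_chi2_convex:
  fixes l p :: "real ^ 'h"
  assumes p: "\<And>i. 1 / 3 \<le> p $ i" and sum_p: "(\<Sum>i\<in>UNIV. p $ i) = 1"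
    and m: "0 < m" and \<delta>: "0 < \<delta>"
  shows "convex_on prob_simplex (B_sq_chi2 l p m \<delta>)"
proof -
  define w :: "real ^ 'h \<Rightarrow> real ^ 'h" where "w = (\<lambda>q. \<chi> i. q $ i / sqrt (p $ i))"
  define d where "d = (\<lambda>q. norm (w (q - p)))"
  define c where "c = root 4 ((12 * real m - 11) / (16 * real m ^ 3 * \<delta>))"
  define \<phi> :: "real \<Rightarrow> real" where "\<phi> = (\<lambda>t. (1 + t\<^sup>2) powr (1 / 4))"
  have p_pos: "0 < p $ i" for i using p[of i] by linarith
  have c: "0 \<le> c" unfolding c_def using m \<delta> by (intro real_root_ge_zero divide_nonneg_nonneg) auto
  have d2: "(\<Sum>i\<in>UNIV. (q $ i)\<^sup>2 / p $ i) = 1 + (d q)\<^sup>2" if "q \<in> prob_simplex" for q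
  proof -
    have sq: "(\<Sum>i\<in>UNIV. q $ i) = 1" using that by (simp add: prob_simplex_def)
    have "(d q)\<^sup>2 = (\<Sum>i\<in>UNIV. (q $ i - p $ i)\<^sup>2 / p $ i)"
      unfolding d_def w_def power2_norm_eq_inner
      by (simp add: inner_vec_def power2_eq_square[symmetric] power_divide less_imp_le[OF p_pos])
    also have "\<dots> = (\<Sum>i\<in>UNIV. (q $ i)\<^sup>2 / p $ i - 2 * q $ i + p $ i)"
    proof (rule sum.cong[OF refl])
      fix i show "(q $ i - p $ i)\<^sup>2 / p $ i = (q $ i)\<^sup>2 / p $ i - 2 * q $ i + p $ i"
        using p_pos[of i] by (simp add: field_simps power2_eq_square)
    qed
    also have "\<dots> = (\<Sum>i\<in>UNIV. (q $ i)\<^sup>2 / p $ i) - 1"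
      by (simp add: sum.distrib sum_subtractf sq sum_p flip: sum_distrib_left)
    finally show ?thesis by simp
  qed
  have d_range: "d q \<in> {0..sqrt 2}" if "q \<in> prob_simplex" for q
  proof -
    have q0: "0 \<le> q $ i" for i
      using that by (simp add: prob_simplex_def)
    have sq: "(\<Sum>i\<in>UNIV. q $ i) = 1"
      using that by (simp add: prob_simplex_def)
    have "(\<Sum>i\<in>UNIV. (q $ i)\<^sup>2 / p $ i) \<le> (\<Sum>i\<in>UNIV. 3 * q $ i)"
    proof (rule sum_mono)
      fix i
      have "q $ i \<le> (\<Sum>i\<in>UNIV. q $ i)" by (rule member_le_sum) (auto simp: q0)
      then have "(q $ i)\<^sup>2 \<le> q $ i"
        unfolding sq power2_eq_square using q0[of i] by (simp add: mult_left_le)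
      also have "\<dots> \<le> q $ i * (3 * p $ i)"
        using mult_left_mono[OF _ q0[of i], of 1 "3 * p $ i"] p[of i] by simp
      finally show "(q $ i)\<^sup>2 / p $ i \<le> 3 * q $ i"
        using p_pos[of i] by (simp add: field_simps)
    qed
    also have "\<dots> = 3" by (simp add: sq flip: sum_distrib_left)
    finally have "(d q)\<^sup>2 \<le> 2" using d2[OF that] by simp
    then show ?thesis by (simp add: d_def real_le_rsqrt)
  qed
  have B: "B_sq_chi2 l p m \<delta> q = (\<Sum>i\<in>UNIV. l $ i * q $ i) + c * \<phi> (d q)"
    if "q \<in> prob_simplex" for q
  proof -
    have "root 4 (1 + (d q)\<^sup>2) = \<phi> (d q)"
      unfolding \<phi>_def by (subst root_powr_inverse) (auto simp: add_pos_nonneg)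
    then show ?thesis
      unfolding B_sq_chi2_def d2[OF that] c_def by (simp only: real_root_mult mult.commute)
  qed
  have \<phi>_mono: "\<phi> s \<le> \<phi> t" if "0 \<le> s" "s \<le> t" for s t
    unfolding \<phi>_def using that by (intro powr_mono2) (auto simp: power_mono)
  show ?thesis
    unfolding convex_on_def
  proof (intro conjI ballI allI impI convex_prob_simplex)
    fix x y :: "real ^ 'h" and u v :: real
    assume x: "x \<in> prob_simplex" and y: "y \<in> prob_simplex"
      and uv: "0 \<le> u" "0 \<le> v" "u + v = 1"
    let ?z = "u *\<^sub>R x + v *\<^sub>R y"
    have z: "?z \<in> prob_simplex" using convexD[OF convex_prob_simplex x y uv] .
    have "u *\<^sub>R p + v *\<^sub>R p = p"
      using uv(3) by (simp flip: scaleR_add_left)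
    then have "?z - p = u *\<^sub>R (x - p) + v *\<^sub>R (y - p)"
      by (simp add: algebra_simps)
    then have "w (?z - p) = u *\<^sub>R w (x - p) + v *\<^sub>R w (y - p)"
      by (simp add: w_def vec_eq_iff add_divide_distrib)
    then have "d ?z \<le> norm (u *\<^sub>R w (x - p)) + norm (v *\<^sub>R w (y - p))"
      unfolding d_def by (metis norm_triangle_ineq)
    then have "d ?z \<le> u *\<^sub>R d x + v *\<^sub>R d y"
      using uv by (simp add: d_def)
    then have "\<phi> (d ?z) \<le> \<phi> (u *\<^sub>R d x + v *\<^sub>R d y)"
      by (intro \<phi>_mono) (auto simp: d_def)
    also have "\<dots> \<le> u * \<phi> (d x) + v * \<phi> (d y)"
      using convex_on_powr_quarter d_range[OF x] d_range[OF y] uv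
      unfolding convex_on_def \<phi>_def by blast
    finally have "c * \<phi> (d ?z) \<le> c * (u * \<phi> (d x) + v * \<phi> (d y))"
      using c by (rule mult_left_mono)
    moreover have "(\<Sum>i\<in>UNIV. l $ i * ?z $ i) =
        u * (\<Sum>i\<in>UNIV. l $ i * x $ i) + v * (\<Sum>i\<in>UNIV. l $ i * y $ i)"
      by (simp add: sum_distrib_left sum.distrib algebra_simps)
    ultimately show "B_sq_chi2 l p m \<delta> ?z \<le> u * B_sq_chi2 l p m \<delta> x + v * B_sq_chi2 l p m \<delta> y"
      unfolding B[OF x] B[OF y] B[OF z] by (simp add: algebra_simps)
  qed
qed

end

theory Submission
  imports Defs
begin

text \<open>
  At \<open>Q = P\<close> the chi-squared sum takes its minimal value \<open>1\<close>. On the segment from \<open>P\<close> to the vertex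
  \<open>e\<^sub>i\<close> it equals \<open>1 + D t\<^sup>2\<close> with \<open>D = 1 / p\<^sub>i - 1\<close> (\<open>chi2_sum_towards_vertex\<close>). In the
  parameter \<open>s = sqrt D * t\<close>, which runs over \<open>[0, sqrt D]\<close>, the bound is therefore an affine
  function of \<open>s\<close> plus a positive multiple of \<open>(1 + s\<^sup>2) powr (1/4)\<close>. The latter has its
  inflection point at \<open>s = sqrt 2\<close> and is strictly concave, hence not convex, beyond it
  (\<open>powr_quarter_not_convex\<close>). A weight \<open>p\<^sub>i < 1/3\<close> means exactly \<open>D > 2\<close>, so that the segment
  reaches past the inflection point. There the bound is strictly concave along the segment, and
  hence not convex on the simplex.
\<close>

text \<open>
  A convex function lies above its tangents, but by the mean value theorem a function with strictly
  decreasing derivative falls below its tangent to the right of the point of contact.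
\<close>
lemma not_convex_on_if_second_deriv_neg:
  fixes f f' f'' :: "real \<Rightarrow> real"
  assumes "a < b"
    and f': "\<And>x. a < x \<Longrightarrow> x < b \<Longrightarrow> (f has_real_derivative f' x) (at x)"
    and f'': "\<And>x. a < x \<Longrightarrow> x < b \<Longrightarrow> (f' has_real_derivative f'' x) (at x)"
    and neg: "\<And>x. a < x \<Longrightarrow> x < b \<Longrightarrow> f'' x < 0"
  shows "\<not> convex_on {a<..<b} f"
proof
  assume conv: "convex_on {a<..<b} f"
  obtain x where x: "a < x" "x < b" using dense[OF \<open>a < b\<close>] by blast
  obtain y where y: "x < y" "y < b" using dense[OF x(2)] by blast
  have "f y - f x \<ge> f' x * (y - x)"
  proof (rule convex_on_imp_above_tangent[OF conv])
    show "(f has_real_derivative f' x) (at x within {a<..<b})"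
      using f'[OF x] by (rule has_field_derivative_at_within)
  qed (use x y in \<open>auto simp: interior_open\<close>)
  moreover obtain z where z: "x < z" "z < y" "f y - f x = (y - x) * f' z"
    using MVT2[OF y(1), of f f'] f' x y by (metis less_le_trans order.strict_trans2 le_less_trans)
  moreover have "f' z < f' x"
    using x y z f'' neg
    by (intro DERIV_neg_imp_decreasing[OF z(1)]) (meson le_less_trans less_le_trans less_trans)
  ultimately show False
    using y(1) by (simp add: mult.commute)
qed

text \<open>
  The second derivative has the sign of \<open>2 - s\<^sup>2\<close>, so the profile of the bound along the segments
  out of the prior bends downwards beyond \<open>sqrt 2\<close>.
\<close>
lemma powr_quarter_not_convex:
  assumes "sqrt 2 < b"
  shows "\<not> convex_on {sqrt 2<..<b} (\<lambda>s. (1 + s\<^sup>2) powr (1 / 4))"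
proof (rule not_convex_on_if_second_deriv_neg[OF assms])
  have pos: "1 + s\<^sup>2 > 0" for s :: real
    by (simp add: add_pos_nonneg)
  show "((\<lambda>s. (1 + s\<^sup>2) powr (1 / 4)) has_real_derivative
         s / 2 * (1 + s\<^sup>2) powr (- 3 / 4)) (at s)" for s :: real
    by (rule derivative_eq_intros refl pos | simp)+
  show "((\<lambda>s. s / 2 * (1 + s\<^sup>2) powr (- 3 / 4)) has_real_derivative
         (1 / 2 - s\<^sup>2 / 4) * (1 + s\<^sup>2) powr (- 7 / 4)) (at s)" for s :: real
  proof -
    have "(1 + s\<^sup>2) powr (- 3 / 4) = (1 + s\<^sup>2) powr (1 + - 7 / 4)"
      by simp
    also have "\<dots> = (1 + s\<^sup>2) * (1 + s\<^sup>2) powr (- 7 / 4)"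
      using pos[of s] by (subst powr_add) simp
    finally have eq: "(1 + s\<^sup>2) powr (- 3 / 4) = (1 + s\<^sup>2) * (1 + s\<^sup>2) powr (- 7 / 4)" .
    have "((\<lambda>s. s / 2 * (1 + s\<^sup>2) powr (- 3 / 4)) has_real_derivative
         1 / 2 * (1 + s\<^sup>2) powr (- 3 / 4)
         + s / 2 * (- 3 / 4 * (1 + s\<^sup>2) powr (- 7 / 4) * (2 * s))) (at s)"
      by (rule derivative_eq_intros refl pos | simp)+
    then show ?thesis
      by (rule DERIV_cong) (simp only: eq, simp add: field_simps power2_eq_square)
  qed
  show "(1 / 2 - s\<^sup>2 / 4) * (1 + s\<^sup>2) powr (- 7 / 4) < 0" if "sqrt 2 < s" for s :: real
  proof -
    have "(sqrt 2)\<^sup>2 < s\<^sup>2"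
      using that by (intro power_strict_mono) auto
    then show ?thesis
      using pos[of s] by (intro mult_neg_pos) auto
  qed
qed

text \<open>
  There is no term linear in \<open>t\<close> because \<open>p\<close> minimises the chi-squared sum on the simplex. A small
  weight \<open>p\<^sub>i\<close> makes the growth towards the vertex \<open>i\<close> steep.
\<close>
lemma chi2_sum_towards_vertex:
  fixes p :: "real ^ 'h"
  assumes p: "\<And>i. 0 < p $ i" and sum_p: "(\<Sum>i\<in>UNIV. p $ i) = 1"
  shows "(\<Sum>j\<in>UNIV. (((1 - t) *\<^sub>R p + t *\<^sub>R axis i 1) $ j)\<^sup>2 / p $ j) = 1 + (1 / p $ i - 1) * t\<^sup>2"
proof -
  have "(\<Sum>j\<in>UNIV. (((1 - t) *\<^sub>R p + t *\<^sub>R axis i 1) $ j)\<^sup>2 / p $ j) =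
      (\<Sum>j\<in>UNIV. (1 - t)\<^sup>2 * p $ j + (if j = i then 2 * t * (1 - t) + t\<^sup>2 / p $ i else 0))"
  proof (rule sum.cong[OF refl])
    fix j
    show "(((1 - t) *\<^sub>R p + t *\<^sub>R axis i 1) $ j)\<^sup>2 / p $ j =
        (1 - t)\<^sup>2 * p $ j + (if j = i then 2 * t * (1 - t) + t\<^sup>2 / p $ i else 0)"
      using p[of j] by (auto simp: axis_def field_simps power2_eq_square)
  qed
  also have "\<dots> = (1 - t)\<^sup>2 + (2 * t * (1 - t) + t\<^sup>2 / p $ i)"
    by (simp add: sum.distrib sum_p flip: sum_distrib_left)
  also have "\<dots> = 1 + (1 / p $ i - 1) * t\<^sup>2"
    by (simp add: algebra_simps power2_eq_square)
  finally show ?thesis .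
qed

theorem theorem7:
  fixes l p :: "real ^ 'h" and m :: nat and \<delta> :: real
  assumes risk: "\<And>i. 0 \<le> l $ i \<and> l $ i \<le> 1"
    and prior_pos: "\<And>i. 0 < p $ i"
    and prior_sum: "(\<Sum>i\<in>UNIV. p $ i) = 1"
    and m_pos: "0 < m"
    and delta: "0 < \<delta>" "\<delta> < 1"
    and prior_small: "\<exists>i. p $ i < 1 / 3"
  shows "\<not> convex_on prob_simplex (B_sq_chi2 l p m \<delta>)"
proof
  assume conv: "convex_on prob_simplex (B_sq_chi2 l p m \<delta>)"
  obtain i where i: "p $ i < 1 / 3" using prior_small by blast
  define D where "D = 1 / p $ i - 1"
  define c where "c = root 4 ((12 * real m - 11) / (16 * real m ^ 3 * \<delta>))"
  define \<phi> :: "real \<Rightarrow> real" where "\<phi> = (\<lambda>s. (1 + s\<^sup>2) powr (1 / 4))"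
  \<comment> \<open>The segment from \<open>p\<close> to the vertex \<open>i\<close>, scaled so that the chi-squared sum is \<open>1 + s\<^sup>2\<close>.\<close>
  define q :: "real \<Rightarrow> real ^ 'h"
    where "q = (\<lambda>s. (1 - s / sqrt D) *\<^sub>R p + (s / sqrt D) *\<^sub>R axis i 1)"
  have D: "2 < D"
    using i prior_pos[of i] by (simp add: D_def field_simps)
  \<comment> \<open>The numerator \<open>12 m - 11\<close> is positive because \<open>m\<close> is at least 1.\<close>
  have c: "0 < c"
    unfolding c_def using m_pos delta by (intro real_root_gt_zero divide_pos_pos) auto
  have q_simplex: "q s \<in> prob_simplex" if "s \<in> {sqrt 2<..<sqrt D}" for s
  proof -
    have "0 \<le> sqrt 2" by simp
    with that have "0 \<le> s"
      unfolding greaterThanLessThan_iff by linarith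
    then have "0 \<le> s / sqrt D" "s / sqrt D \<le> 1"
      using that D by auto
    moreover have "p \<in> prob_simplex" "axis i 1 \<in> prob_simplex"
      using prior_pos prior_sum by (auto simp: prob_simplex_def axis_def less_imp_le)
    ultimately show ?thesis
      unfolding q_def by (intro convexD[OF convex_prob_simplex]) auto
  qed
  have q_affine: "q (u * x + v * y) = u *\<^sub>R q x + v *\<^sub>R q y" if "u + v = 1" for u v x y
  proof -
    have u: "u = 1 - v" using that by simp
    show ?thesis
      unfolding u by (simp add: q_def vec_eq_iff add_divide_distrib diff_divide_distrib algebra_simps)
  qed
  have B: "B_sq_chi2 l p m \<delta> (q s) = l \<bullet> q s + c * \<phi> s" for s
  proof -
    have "D * (s / sqrt D)\<^sup>2 = s\<^sup>2"
      using D by (simp add: power_divide)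
    then have chi2: "(\<Sum>j\<in>UNIV. (q s $ j)\<^sup>2 / p $ j) = 1 + s\<^sup>2"
      unfolding q_def chi2_sum_towards_vertex[OF prior_pos prior_sum] by (simp add: D_def)
    have "root 4 (1 + s\<^sup>2) = \<phi> s"
      unfolding \<phi>_def by (subst root_powr_inverse) (auto simp: add_pos_nonneg)
    then show ?thesis
      unfolding B_sq_chi2_def chi2 c_def inner_vec_def
      by (simp only: real_root_mult mult.commute inner_real_def)
  qed
  \<comment> \<open>The empirical risk term is linear, so it cancels from the convexity inequality.\<close>
  have "convex_on {sqrt 2<..<sqrt D} \<phi>"
    unfolding convex_on_def
  proof (intro conjI ballI allI impI convex_real_interval)
    fix x y u v :: real
    assume x: "x \<in> {sqrt 2<..<sqrt D}" and y: "y \<in> {sqrt 2<..<sqrt D}"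
      and uv: "0 \<le> u" "0 \<le> v" "u + v = 1"
    let ?z = "u *\<^sub>R x + v *\<^sub>R y"
    have "B_sq_chi2 l p m \<delta> (q ?z) \<le> u * B_sq_chi2 l p m \<delta> (q x) + v * B_sq_chi2 l p m \<delta> (q y)"
      using conv q_simplex[OF x] q_simplex[OF y] uv
      unfolding convex_on_def by (simp add: q_affine)
    moreover have "l \<bullet> q ?z = u * (l \<bullet> q x) + v * (l \<bullet> q y)"
      using uv by (simp add: q_affine inner_add_right)
    ultimately have "c * \<phi> ?z \<le> c * (u * \<phi> x + v * \<phi> y)"
      unfolding B by (simp add: algebra_simps)
    then show "\<phi> ?z \<le> u * \<phi> x + v * \<phi> y"
      using c by simp
  qed
  then show False
    using powr_quarter_not_convex[of "sqrt D"] D by (simp add: \<phi>_def)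
qed

end
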